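(* Given a positive integer $k$, the number of truncated shifted reverse tableaux of shape $\delta_{[k+2,3]}\backslash\delta_{k-1}$ equals $2^{k-1}$.
   Context: A strict reverse partition is a composition $\alpha=(\alpha_1,\ldots,\alpha_k)$ (list of positive integers) with $\alpha_1<\cdots<\alpha_k$. For positive integers $a\geq b$, $\delta_{[a,b]}=(b,b+1,\ldots,a-1,a)$ and $\delta_a=\delta_{[a,1]}=(1,2,\ldots,a)$; $\delta_0$ is the empty composition (no truncation). Let $\alpha=(\alpha_1,\ldots,\alpha_k)$ and $\beta=(\beta_1,\ldots,\beta_s)$ be strict reverse partitions with $s\leq k$ and $\beta_{s-i+1}\leq\alpha_{k-i+1}$ for $1\leq i\leq s$. The truncated shifted reverse diagram of shape $\alpha\backslash\beta$ is the array of cells, rows numbered from top to bottom, where row $i$ (for $2\leq i\leq k$) starts one cell to the left of where row $i-1$ starts, and row $i$ contains $\alpha_i$ (contiguous) cells if $1\leq i\leq k-s$ and $\alpha_i-\beta_{i+s-k}$ cells if $k-s+1\leq i\leq k$. A truncated shifted reverse tableau of shape $\alpha\backslash\beta$ is a filling of the $N$ cells of this diagram with the distinct integers $1,\ldots,N$ (each used once) so that entries decrease from left to right in every row and increase from top to bottom in every column. *)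

theory Defs
  imports Main "HOL-Library.FuncSet"
begin

text \<open>Compositions are lists of naturals. The mathematical indexing of parts, rows and columns
  starts at 1, whereas Isabelle lists are indexed from 0.\<close>

definition part :: "nat list \<Rightarrow> nat \<Rightarrow> nat" where
  "part \<alpha> i = \<alpha> ! (i - 1)"

definition strict_reverse_partition :: "nat list \<Rightarrow> bool" where
  "strict_reverse_partition \<alpha> \<longleftrightarrow> (\<forall>x\<in>set \<alpha>. 0 < x) \<and> sorted_wrt (<) \<alpha>"

definition truncated_shape :: "nat list \<Rightarrow> nat list \<Rightarrow> bool" where
  "truncated_shape \<alpha> \<beta> \<longleftrightarrow>
     strict_reverse_partition \<alpha> \<and> strict_reverse_partition \<beta> \<and> length \<beta> \<le> length \<alpha> \<and>
     (\<forall>i\<in>{1..length \<beta>}. part \<beta> (length \<beta> - i + 1) \<le> part \<alpha> (length \<alpha> - i + 1))"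

text \<open>\<open>delta a b\<close> is \<open>(b, b+1, \<dots>, a)\<close>; in particular \<open>delta a 1\<close> is \<open>(1, \<dots>, a)\<close>, and
  \<open>delta 0 1\<close> is the empty composition.\<close>

definition delta :: "nat \<Rightarrow> nat \<Rightarrow> nat list" where
  "delta a b = [b..<Suc a]"

text \<open>The natural-number subtractions below are only meaningful for a \<open>truncated_shape\<close>, where
  none of them truncates.\<close>

definition row_length :: "nat list \<Rightarrow> nat list \<Rightarrow> nat \<Rightarrow> nat" where
  "row_length \<alpha> \<beta> i =
     (if i \<le> length \<alpha> - length \<beta> then part \<alpha> i
      else part \<alpha> i - part \<beta> (i + length \<beta> - length \<alpha>))"

text \<open>A cell \<open>(i, j)\<close> lies in row \<open>i\<close> (counted from the top) and column \<open>j\<close> (counted from the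
  left). Columns are numbered so that the last row starts in column 1; hence row \<open>i\<close> of \<open>k\<close> rows
  starts in column \<open>k - i + 1\<close>, one cell to the left of the start of row \<open>i - 1\<close>.\<close>

definition diagram :: "nat list \<Rightarrow> nat list \<Rightarrow> (nat \<times> nat) set" where
  "diagram \<alpha> \<beta> = {(i, j). 1 \<le> i \<and> i \<le> length \<alpha> \<and>
     length \<alpha> - i + 1 \<le> j \<and> j \<le> length \<alpha> - i + row_length \<alpha> \<beta> i}"

text \<open>Fillings are taken to be \<open>extensional\<close> (constantly \<open>undefined\<close> outside the diagram), so that
  distinct elements of this set are distinct fillings of the cells.\<close>

definition tableaux :: "nat list \<Rightarrow> nat list \<Rightarrow> (nat \<times> nat \<Rightarrow> nat) set" where
  "tableaux \<alpha> \<beta> = {T \<in> extensional (diagram \<alpha> \<beta>).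
     bij_betw T (diagram \<alpha> \<beta>) {1..card (diagram \<alpha> \<beta>)} \<and>
     (\<forall>i j j'. (i, j) \<in> diagram \<alpha> \<beta> \<and> (i, j') \<in> diagram \<alpha> \<beta> \<and> j < j' \<longrightarrow> T (i, j') < T (i, j)) \<and>
     (\<forall>i i' j. (i, j) \<in> diagram \<alpha> \<beta> \<and> (i', j) \<in> diagram \<alpha> \<beta> \<and> i < i' \<longrightarrow> T (i, j) < T (i', j))}"

lemma truncated_shape_delta:
  assumes "0 < k"
  shows "truncated_shape (delta (k + 2) 3) (delta (k - 1) 1)"
  using assms
  by (auto simp: truncated_shape_def strict_reverse_partition_def delta_def part_def
      nth_append simp del: upt_Suc)

end

(* Every row of the diagram has exactly three cells.  Writing a_i > b_i > c_i for the entries of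
   row i, the column conditions say a_i < b_(i+1), b_i < c_(i+1) and a_i < c_(i+2).  Hence the order
   on the cells is
     c_1 < b_1 < {a_1, c_2} < b_2 < {a_2, c_3} < ... < {a_(k-1), c_k} < b_k < a_k,
   so that b_i = 3i - 1 is forced and the only freedom is which of a_i, c_(i+1) is 3i and which is
   3i + 1, independently for each i < k. *)

theory Submission
  imports Defs
begin

definition strip :: "nat \<Rightarrow> (nat \<times> nat) set" where
  "strip k = {(i, j). 1 \<le> i \<and> i \<le> k \<and> k - i + 1 \<le> j \<and> j \<le> k - i + 3}"

text \<open>Row 1 is not truncated and has 3 cells; row \<open>i\<close> with
  \<open>2 \<le> i\<close> has \<open>(i + 2) - (i - 1) = 3\<close>.\<close>

lemma diagram_delta:
  assumes "0 < k"
  shows "diagram (delta (k + 2) 3) (delta (k - 1) 1) = strip k"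
proof -
  have lengths: "length (delta (k + 2) 3) = k" "length (delta (k - 1) 1) = k - 1"
    using assms by (simp_all add: delta_def del: upt_Suc)
  have "row_length (delta (k + 2) 3) (delta (k - 1) 1) i = 3" if "1 \<le> i" "i \<le> k" for i
    using assms that unfolding row_length_def lengths
    by (auto simp: part_def delta_def simp del: upt_Suc)
  then show ?thesis
    unfolding diagram_def strip_def lengths by force
qed

lemma mem_strip_iff:
  "(i, j) \<in> strip k \<longleftrightarrow> 1 \<le> i \<and> i \<le> k \<and> (j = k - i + 1 \<or> j = k - i + 2 \<or> j = k - i + 3)"
  by (auto simp: strip_def)

lemma card_strip: "card (strip k) = 3 * k"
proof -
  have "strip k = (SIGMA i:{1..k}. {k - i + 1..k - i + 3})"
    by (auto simp: strip_def)
  then show ?thesis by simp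
qed

text \<open>The set \<open>S\<close> collects the rows \<open>i < k\<close> with \<open>a\<^sub>i < c\<^sub>i\<^sub>+\<^sub>1\<close>. The first
  entry of the last row and the last entry of the first row are forced whatever \<open>S\<close> is.\<close>

definition filling :: "nat \<Rightarrow> nat set \<Rightarrow> nat \<times> nat \<Rightarrow> nat" where
  "filling k S = restrict (\<lambda>(i, j).
     if j = k - i + 1 then (if i = k \<or> i \<in> S then 3 * i else 3 * i + 1)
     else if j = k - i + 2 then 3 * i - 1
     else (if i = 1 \<or> i - 1 \<in> S then 3 * i - 2 else 3 * i - 3)) (strip k)"

lemma filling_simps:
  assumes "1 \<le> i" "i \<le> k"
  shows "filling k S (i, k - i + 1) = (if i = k \<or> i \<in> S then 3 * i else 3 * i + 1)"
    and "filling k S (i, k - i + 2) = 3 * i - 1"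
    and "filling k S (i, k - i + 3) = (if i = 1 \<or> i - 1 \<in> S then 3 * i - 2 else 3 * i - 3)"
  using assms by (auto simp: filling_def mem_strip_iff)

text \<open>Bounds valid for every \<open>S\<close>. The sum \<open>i + j\<close> tells the position
  in the row, and avoiding subtraction keeps everything within linear arithmetic.\<close>

lemma filling_cases:
  assumes "(i, j) \<in> strip k"
  shows "i + j = k + 1 \<and> 3 * i \<le> filling k S (i, j) \<and> filling k S (i, j) \<le> 3 * i + 1 \<or>
    i + j = k + 2 \<and> filling k S (i, j) + 1 = 3 * i \<or>
    i + j = k + 3 \<and> 3 * i \<le> filling k S (i, j) + 3 \<and> filling k S (i, j) + 2 \<le> 3 * i"
proof -
  have i: "1 \<le> i" "i \<le> k" and "j = k - i + 1 \<or> j = k - i + 2 \<or> j = k - i + 3"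
    using assms unfolding mem_strip_iff by blast+
  then show ?thesis
    using filling_simps[OF i, of S] by (elim disjE) auto
qed

text \<open>The ranges in \<open>filling_cases\<close> are disjoint except for the first cell of row
  \<open>i\<close> and the last cell of row \<open>i + 1\<close>: both take values in
  \<open>{3 * i, 3 * i + 1}\<close>, and there \<open>i \<in> S\<close> decides oppositely for the
  two.\<close>

lemma filling_inj_on: "inj_on (filling k S) (strip k)"
proof (rule inj_onI, clarify)
  fix i j i' j'
  assume cell: "(i, j) \<in> strip k" and cell': "(i', j') \<in> strip k"
    and eq: "filling k S (i, j) = filling k S (i', j')"
  have *: False
    if "(m, l) \<in> strip k" "(m', l') \<in> strip k" "m' = Suc m" "m + l = k + 1" "m' + l' = k + 3"
      "filling k S (m, l) = filling k S (m', l')" for m l m' l'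
  proof -
    have "l = k - m + 1" "l' = k - m' + 3" "1 \<le> m" "m \<le> k" "1 \<le> m'" "m' \<le> k"
      using that by (auto simp: mem_strip_iff)
    then show False
      using that(3,6) filling_simps(1)[of m k S] filling_simps(3)[of m' k S]
      by (simp split: if_splits)
  qed
  note cells = filling_cases[OF cell, of S] filling_cases[OF cell', of S] eq
  \<comment> \<open>Entries of row \<open>i\<close> lie between \<open>3 * i - 3\<close> and
    \<open>3 * i + 1\<close>, so rows at distance 2 or more share no value.\<close>
  have "i \<le> Suc i'" "i' \<le> Suc i"
    using cells by (elim disjE conjE; linarith)+
  then consider "i = i'" | "i' = Suc i" | "i = Suc i'"
    by linarith
  then show "i = i' \<and> j = j'"
  proof cases
    case 1
    then have "j = j'" using cells by (elim disjE conjE; linarith)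
    with 1 show ?thesis by simp
  next
    case 2
    then have "i + j = k + 1" "i' + j' = k + 3" using cells by (elim disjE conjE; linarith)+
    with *[OF cell cell' 2 _ _ eq] show ?thesis by blast
  next
    case 3
    then have "i' + j' = k + 1" "i + j = k + 3" using cells by (elim disjE conjE; linarith)+
    with *[OF cell' cell 3 _ _ eq[symmetric]] show ?thesis by blast
  qed
qed

lemma filling_range: "filling k S ` strip k \<subseteq> {1..3 * k}"
proof clarify
  fix i j assume "(i, j) \<in> strip k"
  then have i: "1 \<le> i" "i \<le> k" and "j = k - i + 1 \<or> j = k - i + 2 \<or> j = k - i + 3"
    unfolding mem_strip_iff by blast+
  then show "filling k S (i, j) \<in> {1..3 * k}"
    using filling_simps[OF i, of S] by (elim disjE) auto
qed

lemma filling_tableau: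
  assumes "0 < k"
  shows "filling k S \<in> tableaux (delta (k + 2) 3) (delta (k - 1) 1)"
proof -
  \<comment> \<open>An injective image inside a set of the same size \<open>3 * k\<close> is the
    whole set.\<close>
  have "filling k S ` strip k = {1..3 * k}"
    using filling_range by (rule card_subset_eq[rotated])
      (simp_all add: card_image filling_inj_on card_strip)
  then have "bij_betw (filling k S) (strip k) {1..3 * k}"
    by (simp add: bij_betw_def filling_inj_on)
  moreover have "filling k S (i, j') < filling k S (i, j)"
    if "(i, j) \<in> strip k" "(i, j') \<in> strip k" "j < j'" for i j j'
    using that(3) filling_cases[OF that(1), of S] filling_cases[OF that(2), of S]
    by (elim disjE conjE) linarith+
  moreover have "filling k S (i, j) < filling k S (i', j)"
    if "(i, j) \<in> strip k" "(i', j) \<in> strip k" "i < i'" for i i' j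
    using that(3) filling_cases[OF that(1), of S] filling_cases[OF that(2), of S]
    by (elim disjE conjE) linarith+
  ultimately show ?thesis
    unfolding tableaux_def diagram_delta[OF assms] card_strip
    by (auto simp: filling_def)
qed

text \<open>The set is read off from the first cells. Bounds from both ends pin the middle entries,
  which in turn confine all the others.\<close>

lemma tableau_filling:
  assumes "0 < k" and "T \<in> tableaux (delta (k + 2) 3) (delta (k - 1) 1)"
  shows "T = filling k {i \<in> {1..<k}. T (i, k - i + 1) = 3 * i}"
proof -
  define a where "a i = T (i, k - i + 1)" for i
  define b where "b i = T (i, k - i + 2)" for i
  define c where "c i = T (i, k - i + 3)" for i
  have ext: "T \<in> extensional (strip k)"
    and bij: "bij_betw T (strip k) {1..3 * k}"
    and row: "\<And>i j j'. (i, j) \<in> strip k \<Longrightarrow> (i, j') \<in> strip k \<Longrightarrow> j < j' \<Longrightarrow> T (i, j') < T (i, j)"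
    and col: "\<And>i i' j. (i, j) \<in> strip k \<Longrightarrow> (i', j) \<in> strip k \<Longrightarrow> i < i' \<Longrightarrow> T (i, j) < T (i', j)"
    using assms(2) unfolding tableaux_def diagram_delta[OF assms(1)] card_strip by blast+
  have rows: "b i < a i" "c i < b i" if "1 \<le> i" "i \<le> k" for i
    using that unfolding a_def b_def c_def by (auto intro!: row simp: mem_strip_iff)
  \<comment> \<open>Row \<open>i + 1\<close> starts one cell further left, so the first and middle
    cells of row \<open>i\<close> lie above the middle and last cells of row
    \<open>i + 1\<close>.\<close>
  have cols: "a i < b (Suc i)" "b i < c (Suc i)" if "1 \<le> i" "i < k" for i
  proof -
    have "k - i + 1 = k - Suc i + 2" "k - i + 2 = k - Suc i + 3" using that by auto
    moreover have "T (i, k - i + 1) < T (Suc i, k - i + 1)" "T (i, k - i + 2) < T (Suc i, k - i + 2)"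
      using that by (auto intro!: col simp: mem_strip_iff)
    ultimately show "a i < b (Suc i)" "b i < c (Suc i)"
      by (simp_all only: a_def b_def c_def)
  qed
  have distinct: "a i \<noteq> c (Suc i)" if "1 \<le> i" "i < k" for i
  proof
    assume "a i = c (Suc i)"
    then have "(i, k - i + 1) = (Suc i, k - Suc i + 3)"
      using that unfolding a_def c_def
      by (intro inj_onD[OF bij_betw_imp_inj_on[OF bij]]) (auto simp: mem_strip_iff)
    then show False by simp
  qed
  have range: "T x \<in> {1..3 * k}" if "x \<in> strip k" for x
    using bij that by (auto dest: bij_betwE)
  have c1: "1 \<le> c 1" and ak: "a k \<le> 3 * k"
    using range[of "(1, k - 1 + 3)"] range[of "(k, k - k + 1)"] assms(1)
    by (auto simp: a_def c_def mem_strip_iff)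
  have link: "b i < a i" "b i < c (Suc i)" "a i < b (Suc i)" "c (Suc i) < b (Suc i)"
    "a i \<noteq> c (Suc i)" if "1 \<le> i" "i < k" for i
    using that rows(1)[of i] rows(2)[of "Suc i"] cols[of i] distinct[of i] by simp_all
  have "1 \<le> k" using assms(1) by simp
  have first: "c 1 < b 1" and last: "b k < a k"
    using rows \<open>1 \<le> k\<close> by blast+
  \<comment> \<open>Two distinct values, \<open>a n\<close> and \<open>c (Suc n)\<close>, lie
    strictly between \<open>b n\<close> and \<open>b (Suc n)\<close>, so \<open>b\<close> grows by
    at least 3 per row, starting from \<open>b 1 \<ge> 2\<close>.\<close>
  have lower: "3 * i \<le> b i + 1" if "1 \<le> i" "i \<le> k" for i
    using that
  proof (induction i rule: dec_induct)
    case base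
    show ?case using c1 first by linarith
  next
    case (step n)
    then have n: "1 \<le> n" "n < k" and "3 * n \<le> b n + 1" by simp_all
    with link[OF n] show ?case by arith
  qed
  \<comment> \<open>The same growth, counted upwards from the last row, where
    \<open>b k < a k \<le> 3 * k\<close>.\<close>
  have upper: "b i + 1 \<le> 3 * i" if "1 \<le> i" "i \<le> k" for i
    using that(2,1)
  proof (induction i rule: inc_induct)
    case base
    show ?case using ak last by linarith
  next
    case (step n)
    then have n: "1 \<le> n" "n < k" and "b (Suc n) + 1 \<le> 3 * Suc n" by simp_all
    with link[OF n] show ?case by arith
  qed
  have b: "b i = 3 * i - 1" if "1 \<le> i" "i \<le> k" for i
    using lower[OF that] upper[OF that] by simp
  have between: "a i = 3 * i \<and> c (Suc i) = 3 * i + 1 \<or> a i = 3 * i + 1 \<and> c (Suc i) = 3 * i"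
    if "1 \<le> i" "i < k" for i
  proof -
    have "b i = 3 * i - 1" "b (Suc i) = 3 * i + 2"
      using that b[of i] b[of "Suc i"] by simp_all
    with link[OF that] have "3 * i \<le> a i" "a i \<le> 3 * i + 1" "3 * i \<le> c (Suc i)" "c (Suc i) \<le> 3 * i + 1"
      by linarith+
    with link(5)[OF that] show ?thesis by arith
  qed
  have ends: "c 1 = 1" "a k = 3 * k"
    using b[of 1] b[of k] \<open>1 \<le> k\<close> first last c1 ak by simp_all
  let ?S = "{i \<in> {1..<k}. T (i, k - i + 1) = 3 * i}"
  have S: "i \<in> ?S \<longleftrightarrow> 1 \<le> i \<and> i < k \<and> a i = 3 * i" for i
    by (auto simp: a_def)
  have "T (i, j) = filling k ?S (i, j)" if "(i, j) \<in> strip k" for i j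
  proof -
    have i: "1 \<le> i" "i \<le> k" using that by (simp_all add: mem_strip_iff)
    have "a i = filling k ?S (i, k - i + 1)"
      unfolding filling_simps[OF i] S using i ends between[of i] by (cases "i = k") auto
    moreover have "b i = filling k ?S (i, k - i + 2)"
      unfolding filling_simps[OF i] using i by (rule b)
    \<comment> \<open>The last cell of row \<open>i\<close> is the partner of the first cell of row
      \<open>i - 1\<close>, hence the shifted index.\<close>
    moreover have "c i = filling k ?S (i, k - i + 3)"
      unfolding filling_simps[OF i] S using i ends between[of "i - 1"] by (cases "i = 1") auto
    ultimately show ?thesis
      using that by (auto simp: mem_strip_iff a_def b_def c_def)
  qed
  then show ?thesis
    using ext by (intro extensionalityI[of _ "strip k"]) (auto simp: filling_def)
qed

text \<open>For \<open>i < k\<close> the first cell of row \<open>i\<close> holds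
  \<open>3 * i\<close> or \<open>3 * i + 1\<close> according to whether \<open>i \<in> S\<close>, so
  the filling reveals \<open>S\<close>.\<close>

lemma filling_inj: "inj_on (filling k) (Pow {1..<k})"
proof (rule inj_onI)
  fix S S' assume "S \<in> Pow {1..<k}" "S' \<in> Pow {1..<k}" and eq: "filling k S = filling k S'"
  then have "S \<subseteq> {1..<k}" "S' \<subseteq> {1..<k}" by auto
  moreover have "i \<in> S \<longleftrightarrow> i \<in> S'" if "1 \<le> i" "i < k" for i
    using that filling_simps(1)[of i k S] filling_simps(1)[of i k S'] eq
    by (auto split: if_splits)
  ultimately show "S = S'" by fastforce
qed

theorem corollary8p14:
  fixes k :: nat
  assumes "0 < k"
  shows "card (tableaux (delta (k + 2) 3) (delta (k - 1) 1)) = 2 ^ (k - 1)"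
proof -
  have "tableaux (delta (k + 2) 3) (delta (k - 1) 1) = filling k ` Pow {1..<k}"
  proof (intro equalityI subsetI)
    fix T assume "T \<in> tableaux (delta (k + 2) 3) (delta (k - 1) 1)"
    from tableau_filling[OF assms this] show "T \<in> filling k ` Pow {1..<k}"
      by (rule image_eqI) auto
  qed (use filling_tableau[OF assms] in auto)
  then show ?thesis
    by (simp only: card_image[OF filling_inj] card_Pow[OF finite_atLeastLessThan] card_atLeastLessThan)
qed

end
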